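(* Let $x(0)=(x_1(0),\dots,x_n(0))\in\mathbb{R}^n$ be an ordered initial profile, i.e. $x_1(0)\le\dots\le x_n(0)$, and let $0<\mu<\tfrac12$. Let $\varepsilon_{\mathrm{high}}$ be the biggest $\varepsilon$ for which preventing consensus from $x(0)$ is possible. Then $$\varepsilon_{\mathrm{high}}=\max_{k\in\{1,\dots,n-1\}}\left(\frac{1}{n-k}\sum_{i=k+1}^{n}x_i(0)-\frac1k\sum_{j=1}^{k}x_j(0)\right).$$
   Context: A communication regime for $n$ agents is a sequence $((i_t,j_t))_{t\in\mathbb{N}_0}$ of pairs of agents $i_t\neq j_t$ in $\{1,\dots,n\}$, saying who communicates with whom at each time step. Given $x(0)\in\mathbb{R}^n$, a bound of confidence $\varepsilon>0$, a cautiousness parameter $\mu\in(0,\tfrac12]$ and a communication regime, the Weisbuch-Deffuant (WD) opinion dynamics $(x(t))_{t\in\mathbb{N}_0}$ is defined as follows. At time $t$, with $i=i_t$, $j=j_t$: if $|x_i(t)-x_j(t)|<\varepsilon$, then $x_i(t+1)=(1-\mu)x_i(t)+\mu x_j(t)$ and $x_j(t+1)=\mu x_i(t)+(1-\mu)x_j(t)$; otherwise $x_i(t+1)=x_i(t)$ and $x_j(t+1)=x_j(t)$. All other opinions are unchanged. A communication regime leads to a consensus (for given $x(0),\varepsilon,\mu$) if all opinions $x_k(t)$ converge to one common value as $t\to\infty$. For given $x(0),\mu,\varepsilon$, preventing consensus is possible if it can be done even when one switches at some time step to an arbitrary communication regime: there exist $T\in\mathbb{N}_0$ and pairs $(i_0,j_0),\dots,(i_{T-1},j_{T-1})$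 such that no communication regime whose first $T$ pairs are these leads to a consensus. The number $\varepsilon_{\mathrm{high}}$, the biggest such $\varepsilon$ (an attained maximum), depends on $x(0)$.
   Formalization: "Biggest ε" is read as the supremum, with value 0 when consensus can never be prevented (constant profiles): the maximum need not be attained, e.g. for x(0)=(0,1/5,1) it is not attained at 9/10. Attainment is not claimed. *)

theory Defs
  imports Complex_Main
begin

(* A profile of n agents is a function whose values at 1, ..., n are the opinions;
   values outside {1..n} are irrelevant. *)

definition agent_pairs :: "nat \<Rightarrow> (nat \<times> nat) set" where
  "agent_pairs n = {(i, j). i \<in> {1..n} \<and> j \<in> {1..n} \<and> i \<noteq> j}"

definition communication_regime :: "nat \<Rightarrow> (nat \<Rightarrow> nat \<times> nat) \<Rightarrow> bool" where
  "communication_regime n r \<longleftrightarrow> (\<forall>t. r t \<in> agent_pairs n)"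

definition wd_step :: "real \<Rightarrow> real \<Rightarrow> nat \<times> nat \<Rightarrow> (nat \<Rightarrow> real) \<Rightarrow> (nat \<Rightarrow> real)" where
  "wd_step \<epsilon> \<mu> p x =
     (case p of (i, j) \<Rightarrow>
        if \<bar>x i - x j\<bar> < \<epsilon>
        then x(i := (1 - \<mu>) * x i + \<mu> * x j, j := \<mu> * x i + (1 - \<mu>) * x j)
        else x)"

primrec wd :: "real \<Rightarrow> real \<Rightarrow> (nat \<Rightarrow> real) \<Rightarrow> (nat \<Rightarrow> nat \<times> nat) \<Rightarrow> nat \<Rightarrow> (nat \<Rightarrow> real)" where
  "wd \<epsilon> \<mu> x r 0 = x"
| "wd \<epsilon> \<mu> x r (Suc t) = wd_step \<epsilon> \<mu> (r t) (wd \<epsilon> \<mu> x r t)"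

definition leads_to_consensus ::
    "nat \<Rightarrow> real \<Rightarrow> real \<Rightarrow> (nat \<Rightarrow> real) \<Rightarrow> (nat \<Rightarrow> nat \<times> nat) \<Rightarrow> bool" where
  "leads_to_consensus n \<epsilon> \<mu> x r \<longleftrightarrow>
     (\<exists>c. \<forall>k\<in>{1..n}. (\<lambda>t. wd \<epsilon> \<mu> x r t k) \<longlonglongrightarrow> c)"

definition preventing_consensus_possible ::
    "nat \<Rightarrow> real \<Rightarrow> real \<Rightarrow> (nat \<Rightarrow> real) \<Rightarrow> bool" where
  "preventing_consensus_possible n \<epsilon> \<mu> x \<longleftrightarrow>
     (\<exists>T p. (\<forall>t<T. p t \<in> agent_pairs n) \<and>
        (\<forall>r. communication_regime n r \<and> (\<forall>t<T. r t = p t) \<longrightarrow>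
             \<not> leads_to_consensus n \<epsilon> \<mu> x r))"

(* The supremum is taken in [0, \<infinity>), so it is 0 if consensus cannot be prevented for any
   positive confidence bound (which happens for constant profiles).  Whenever a biggest
   admissible bound exists it equals this supremum, but for \<mu> < 1/2 it need not exist: for
   the profile (0, 1/5, 1) the supremum is 9/10, yet at \<epsilon> = 9/10 consensus cannot be
   prevented, since the opinions of the first two agents never coincide in finite time. *)

definition eps_high :: "nat \<Rightarrow> real \<Rightarrow> (nat \<Rightarrow> real) \<Rightarrow> real" where
  "eps_high n \<mu> x = Sup (insert 0 {\<epsilon>. 0 < \<epsilon> \<and> preventing_consensus_possible n \<epsilon> \<mu> x})"

end

(* For a set S of agents consider the mean opinion outside S minus the mean opinion in S, and the
   maximum M of this quantity over all S.  A communication step replaces the profile by a convex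
   combination of itself and a transposed copy, so M never increases; for a sorted profile M is
   attained at an initial segment {1..k}.

   If M < eps, then at every time a close pair exists whose distance is at least the diameter
   divided by n.  Always choosing such a pair, the sum of squares converges, hence its decrements
   and the diameter tend to 0.

   If eps < M, contract adjacent gaps inside the two groups {1..k} and {k+1..n}.  This keeps both
   group means and the order (here mu <= 1/2 is needed), and the sum of squares drops by a fixed
   amount while some gap inside a group is large.  So eventually the gap between the groups, or
   earlier some gap inside a group, is at least eps; such a gap is never bridged. *)

theory Submission
  imports Defs "HOL-Combinatorics.Transposition"
begin

section \<open>Mean gaps and the effect of a single step\<close>

definition mean_gap :: "nat \<Rightarrow> nat set \<Rightarrow> (nat \<Rightarrow> real) \<Rightarrow> real" where
  "mean_gap n S y = (\<Sum>i\<in>{1..n} - S. y i) / real (card ({1..n} - S)) - (\<Sum>i\<in>S. y i) / real (card S)"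

text \<open>The maximum ranges over all nonempty proper subsets, not only initial segments, because
  arbitrary communication can destroy the order of the opinions.\<close>

definition max_gap :: "nat \<Rightarrow> (nat \<Rightarrow> real) \<Rightarrow> real" where
  "max_gap n y = Max ((\<lambda>S. mean_gap n S y) ` {S. S \<noteq> {} \<and> S \<subset> {1..n}})"

lemma wd_step_far: "\<not> \<bar>y i - y j\<bar> < \<epsilon> \<Longrightarrow> wd_step \<epsilon> \<mu> (i, j) y = y"
  by (simp add: wd_step_def)

text \<open>Mixing the profile with its transposed copy is the form in which a linear quantity such
  as \<open>mean_gap\<close> can be estimated by convexity.\<close>

lemma wd_step_close:
  assumes "i \<noteq> j" "\<bar>y i - y j\<bar> < \<epsilon>"
  shows "wd_step \<epsilon> \<mu> (i, j) y = (\<lambda>k. (1 - \<mu>) * y k + \<mu> * y (transpose i j k))"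
  using assms by (auto simp: wd_step_def transpose_def fun_eq_iff algebra_simps)

text \<open>The identity as \<open>h\<close> yields conservation of the sum, the square as
  \<open>h\<close> the exact loss in the sum of squares.\<close>

lemma sum_wd_step:
  fixes h :: "real \<Rightarrow> real"
  assumes "finite A" "i \<in> A" "j \<in> A" "i \<noteq> j" "\<bar>y i - y j\<bar> < \<epsilon>"
  shows "(\<Sum>k\<in>A. h (wd_step \<epsilon> \<mu> (i, j) y k)) = (\<Sum>k\<in>A. h (y k))
     + h ((1 - \<mu>) * y i + \<mu> * y j) + h (\<mu> * y i + (1 - \<mu>) * y j) - h (y i) - h (y j)"
proof -
  have split: "(\<Sum>k\<in>A. f k) = f i + f j + (\<Sum>k\<in>A - {i} - {j}. f k)" for f :: "nat \<Rightarrow> real"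
    using assms by (simp add: sum.remove[of A i] sum.remove[of "A - {i}" j])
  have "(\<Sum>k\<in>A - {i} - {j}. h (wd_step \<epsilon> \<mu> (i, j) y k)) = (\<Sum>k\<in>A - {i} - {j}. h (y k))"
    by (rule sum.cong) (auto simp: wd_step_def)
  then show ?thesis
    unfolding split[of "\<lambda>k. h (wd_step \<epsilon> \<mu> (i, j) y k)"] split[of "\<lambda>k. h (y k)"]
    using assms by (simp add: wd_step_def)
qed

lemma sum_wd_step_eq:
  assumes "finite A" "i \<in> A \<longleftrightarrow> j \<in> A" "i \<noteq> j"
  shows "(\<Sum>k\<in>A. wd_step \<epsilon> \<mu> (i, j) y k) = (\<Sum>k\<in>A. y k)"
proof (cases "\<bar>y i - y j\<bar> < \<epsilon>")
  case close: True
  show ?thesis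
  proof (cases "i \<in> A")
    case True
    then show ?thesis
      using sum_wd_step[of A i j y \<epsilon> "\<lambda>v. v" \<mu>] assms close by (simp add: algebra_simps)
  next
    case False
    then show ?thesis
      using assms by (intro sum.cong) (auto simp: wd_step_def)
  qed
qed (simp add: wd_step_far)

lemma sum_squares_wd_step:
  assumes "finite A" "i \<in> A" "j \<in> A" "i \<noteq> j" "\<bar>y i - y j\<bar> < \<epsilon>"
  shows "(\<Sum>k\<in>A. (wd_step \<epsilon> \<mu> (i, j) y k)\<^sup>2) = (\<Sum>k\<in>A. (y k)\<^sup>2) - 2 * \<mu> * (1 - \<mu>) * (y i - y j)\<^sup>2"
  using sum_wd_step[of A i j y \<epsilon> "\<lambda>v. v\<^sup>2" \<mu>, OF assms]
  by (simp add: power2_eq_square algebra_simps)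

section \<open>Monotonicity of the maximal mean gap\<close>

lemma finite_proper_subsets: "finite {S. S \<noteq> {} \<and> S \<subset> {1..n::nat}}"
  by (rule finite_subset[of _ "Pow {1..n}"]) auto

lemma singleton_psubset:
  assumes "n \<ge> 2"
  shows "{1} \<subset> {1..n::nat}"
proof -
  have "{1} \<subseteq> {1..n}" "2 \<in> {1..n}" "2 \<notin> {1::nat}" using assms by simp_all
  then show ?thesis by blast
qed

lemma mean_gap_le_max_gap:
  "S \<noteq> {} \<Longrightarrow> S \<subset> {1..n} \<Longrightarrow> mean_gap n S y \<le> max_gap n y"
  unfolding max_gap_def using finite_proper_subsets by (intro Max_ge finite_imageI) auto

lemma max_gap_le:
  assumes "n \<ge> 2" "\<And>S. S \<noteq> {} \<Longrightarrow> S \<subset> {1..n} \<Longrightarrow> mean_gap n S y \<le> m"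
  shows "max_gap n y \<le> m"
proof -
  have "{1} \<in> {S. S \<noteq> {} \<and> S \<subset> {1..n}}" using singleton_psubset[OF assms(1)] by simp
  then show ?thesis
    unfolding max_gap_def using assms(2) finite_proper_subsets
    by (intro Max.boundedI finite_imageI) auto
qed

text \<open>\<open>mean_gap\<close> is linear in the profile, and transposing the profile amounts to
  transposing \<open>S\<close>. For an interacting pair the new value is therefore an average of the
  mean gaps of two nonempty proper subsets.\<close>

lemma mean_gap_wd_step:
  assumes "(i, j) \<in> agent_pairs n" "S \<noteq> {}" "S \<subset> {1..n}" "0 \<le> \<mu>" "\<mu> \<le> 1"
  shows "mean_gap n S (wd_step \<epsilon> \<mu> (i, j) y) \<le> max_gap n y"
proof (cases "\<bar>y i - y j\<bar> < \<epsilon>")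
  case True
  let ?\<tau> = "transpose i j"
  have ij: "i \<in> {1..n}" "j \<in> {1..n}" "i \<noteq> j" using assms(1) by (auto simp: agent_pairs_def)
  have img: "?\<tau> ` {1..n} = {1..n}" using ij by (intro transpose_image_eq) auto
  have compl: "?\<tau> ` ({1..n} - S) = {1..n} - ?\<tau> ` S"
    using image_set_diff[of ?\<tau> "{1..n}" S] img by (simp add: inj_transpose)
  have reindex: "(\<Sum>k\<in>A. y (?\<tau> k)) = (\<Sum>k\<in>?\<tau> ` A. y k)" for A
    by (subst sum.reindex) (auto intro: inj_on_subset[OF inj_transpose])
  have card: "card (?\<tau> ` A) = card A" for A
    by (intro card_image inj_on_subset[OF inj_transpose]) simp
  have "mean_gap n S (wd_step \<epsilon> \<mu> (i, j) y)
      = (1 - \<mu>) * mean_gap n S y + \<mu> * mean_gap n S (\<lambda>k. y (?\<tau> k))"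
    unfolding wd_step_close[OF ij(3) True] mean_gap_def sum.distrib sum_distrib_left[symmetric]
    by (simp add: add_divide_distrib diff_divide_distrib algebra_simps)
  also have "mean_gap n S (\<lambda>k. y (?\<tau> k)) = mean_gap n (?\<tau> ` S) y"
    unfolding mean_gap_def reindex compl[symmetric] card ..
  also have "?\<tau> ` S \<noteq> {} \<and> ?\<tau> ` S \<subset> {1..n}"
    using assms(2,3) img by (metis image_is_empty inj_image_eq_iff inj_transpose psubset_eq image_mono)
  then have "(1 - \<mu>) * mean_gap n S y + \<mu> * mean_gap n (?\<tau> ` S) y
      \<le> (1 - \<mu>) * max_gap n y + \<mu> * max_gap n y"
    using assms by (intro add_mono mult_left_mono mean_gap_le_max_gap) auto
  finally show ?thesis by (simp add: algebra_simps)
qed (use assms in \<open>simp add: wd_step_far mean_gap_le_max_gap del: One_nat_def\<close>)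

lemma max_gap_wd_step:
  assumes "n \<ge> 2" "p \<in> agent_pairs n" "0 \<le> \<mu>" "\<mu> \<le> 1"
  shows "max_gap n (wd_step \<epsilon> \<mu> p y) \<le> max_gap n y"
  using assms by (cases p) (auto intro!: max_gap_le mean_gap_wd_step)

lemma max_gap_wd:
  assumes "n \<ge> 2" "\<And>s. s < t \<Longrightarrow> r s \<in> agent_pairs n" "0 \<le> \<mu>" "\<mu> \<le> 1"
  shows "max_gap n (wd \<epsilon> \<mu> x r t) \<le> max_gap n x"
  using assms(2)
proof (induction t)
  case (Suc t)
  have "max_gap n (wd \<epsilon> \<mu> x r (Suc t)) \<le> max_gap n (wd \<epsilon> \<mu> x r t)"
    using Suc.prems assms by (simp add: max_gap_wd_step)
  then show ?case using Suc by fastforce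
qed simp

section \<open>Reaching consensus when the maximal mean gap is below the bound\<close>

text \<open>A mean lies between minimum and maximum, so an agent with the largest opinion in
  \<open>S\<close> and one with the smallest opinion outside \<open>S\<close> will do.\<close>

lemma mean_gap_witness:
  assumes "S \<noteq> {}" "S \<subset> {1..n}"
  obtains i j where "i \<in> S" "j \<in> {1..n} - S" "y j - y i \<le> mean_gap n S y"
proof -
  let ?R = "{1..n} - S"
  have fin: "finite S" "finite ?R" using assms finite_subset[of S "{1..n}"] by auto
  have ne: "?R \<noteq> {}" using assms by auto
  define a where "a = Max (y ` S)"
  define b where "b = Min (y ` ?R)"
  have "a \<in> y ` S" unfolding a_def using fin assms by (intro Max_in) auto
  then obtain i where i: "i \<in> S" "a = y i" by auto
  have "b \<in> y ` ?R" unfolding b_def using fin ne by (intro Min_in) auto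
  then obtain j where j: "j \<in> ?R" "b = y j" by auto
  have "(\<Sum>k\<in>S. y k) \<le> real (card S) * a"
    unfolding a_def using fin by (intro sum_bounded_above) auto
  then have "(\<Sum>k\<in>S. y k) / real (card S) \<le> a"
    using fin assms by (simp add: divide_simps card_gt_0_iff mult.commute)
  moreover have "real (card ?R) * b \<le> (\<Sum>k\<in>?R. y k)"
    unfolding b_def using fin by (intro sum_bounded_below) auto
  then have "b \<le> (\<Sum>k\<in>?R. y k) / real (card ?R)"
    using fin ne card_gt_0_iff[of ?R] by (simp add: pos_le_divide_eq mult.commute)
  ultimately have "y j - y i \<le> mean_gap n S y"
    unfolding mean_gap_def using i j by linarith
  then show thesis using that i j by blast
qed

text \<open>By \<open>mean_gap_witness\<close>, every nonempty proper sublevel set has an agent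
  outside it that is close to one inside. With \<open>g\<close> the largest distance of a close
  pair, climbing from the minimum in steps of \<open>g\<close> gains an agent each time, so
  \<open>n\<close> steps reach everybody.\<close>

lemma wide_close_pair:
  assumes "n \<ge> 2" "max_gap n y < \<epsilon>"
  shows "\<exists>p\<in>agent_pairs n. \<bar>y (fst p) - y (snd p)\<bar> < \<epsilon> \<and>
    (\<forall>a\<in>{1..n}. \<forall>b\<in>{1..n}. \<bar>y a - y b\<bar> \<le> real n * \<bar>y (fst p) - y (snd p)\<bar>)"
proof -
  define P where "P = {p \<in> agent_pairs n. \<bar>y (fst p) - y (snd p)\<bar> < \<epsilon>}"
  define d where "d = (\<lambda>p. \<bar>y (fst p) - y (snd p)\<bar>)"
  define m where "m = Min (y ` {1..n})"
  have "m \<in> y ` {1..n}" unfolding m_def using assms by (intro Min_in) auto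
  then obtain c where c: "c \<in> {1..n}" "y c = m" by auto
  have m_le: "m \<le> y k" if "k \<in> {1..n}" for k unfolding m_def using that by auto
  have "finite P"
    unfolding P_def agent_pairs_def by (rule finite_subset[of _ "{1..n} \<times> {1..n}"]) auto
  have pair: "\<exists>i\<in>{k\<in>{1..n}. y k \<le> v}. \<exists>j\<in>{1..n} - {k\<in>{1..n}. y k \<le> v}. (j, i) \<in> P"
    if v: "m \<le> v" "{k\<in>{1..n}. y k \<le> v} \<noteq> {1..n}" for v
  proof -
    let ?S = "{k\<in>{1..n}. y k \<le> v}"
    have S: "?S \<noteq> {}" "?S \<subset> {1..n}" using c v by auto
    obtain i j where ij: "i \<in> ?S" "j \<in> {1..n} - ?S" "y j - y i \<le> mean_gap n ?S y"
      by (rule mean_gap_witness[OF S, where y = y])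
    then have "y j - y i < \<epsilon>" using mean_gap_le_max_gap[OF S, of y] assms by linarith
    then have "(j, i) \<in> P" using ij by (auto simp: P_def agent_pairs_def)
    then show ?thesis using ij by blast
  qed
  \<comment> \<open>Equal opinions leave no proper sublevel set at level \<open>m\<close>. In that
    case \<open>0 \<le> max_gap n y < \<epsilon>\<close> makes agents 1 and 2, at distance 0, a
    close pair.\<close>
  have "P \<noteq> {}"
  proof (cases "{k\<in>{1..n}. y k \<le> m} = {1..n}")
    case True
    then have "y k = m" if "k \<in> {1..n}" for k using that m_le[OF that]
      by (intro antisym) blast+
    then have "y 1 = m" "y 2 = m" using assms(1) by simp_all
    moreover have "max_gap n y \<ge> 0"
    proof -
      have S: "{1::nat} \<noteq> {}" "{1} \<subset> {1..n}" using singleton_psubset[OF assms(1)] by simp_all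
      obtain i j where ij: "i \<in> {1}" "j \<in> {1..n} - {1}" "y j - y i \<le> mean_gap n {1} y"
        by (rule mean_gap_witness[OF S, where y = y])
      moreover have "y j \<ge> m" using m_le ij by auto
      ultimately show ?thesis using \<open>y 1 = m\<close> mean_gap_le_max_gap[OF S, of y] by auto
    qed
    ultimately have "(1, 2) \<in> P" using assms by (auto simp: P_def agent_pairs_def)
    then show ?thesis by auto
  next
    case False
    then show ?thesis using pair[of m] by auto
  qed
  define g where "g = Max (d ` P)"
  have "g \<in> d ` P" unfolding g_def using \<open>finite P\<close> \<open>P \<noteq> {}\<close> by (intro Max_in) auto
  then obtain p where p: "p \<in> P" "d p = g" by auto
  have d_le: "d q \<le> g" if "q \<in> P" for q unfolding g_def using that \<open>finite P\<close> by auto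
  have "g \<ge> 0" using p by (auto simp: d_def)
  let ?L = "\<lambda>l. {k\<in>{1..n}. y k \<le> m + real l * g}"
  \<comment> \<open>The set at level \<open>m + real l * g\<close> has at least \<open>l + 1\<close>
    agents until it is full; the minimiser \<open>c\<close> starts the count.\<close>
  have card_L: "min n (Suc l) \<le> card (?L l)" for l
  proof (induction l)
    case 0
    have "card {c} \<le> card (?L 0)" using c by (intro card_mono) auto
    then show ?case by simp
  next
    case (Suc l)
    have sub: "?L l \<subseteq> ?L (Suc l)"
      using \<open>g \<ge> 0\<close> by (auto simp: algebra_simps)
    show ?case
    proof (cases "?L l = {1..n}")
      case True
      then have "?L (Suc l) = {1..n}" using sub by blast
      then show ?thesis by simp
    next
      case False
      have "m \<le> m + real l * g" using \<open>g \<ge> 0\<close> by simp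
      then obtain i j where ij: "i \<in> ?L l" "j \<in> {1..n} - ?L l" "(j, i) \<in> P"
        using pair[OF _ False] by meson
      have "y j - y i \<le> g" using d_le[OF ij(3)] by (auto simp: d_def)
      then have "j \<in> ?L (Suc l)" using ij by (auto simp: algebra_simps)
      then have "insert j (?L l) \<subseteq> ?L (Suc l)" using sub by blast
      then have "card (insert j (?L l)) \<le> card (?L (Suc l))" by (intro card_mono) auto
      then show ?thesis using Suc.IH ij by auto
    qed
  qed
  have "?L n = {1..n}"
    using card_L[of n] by (intro card_seteq) auto
  then have upper: "y k \<le> m + real n * g" if "k \<in> {1..n}" for k using that by blast
  have "\<bar>y a - y b\<bar> \<le> real n * g" if "a \<in> {1..n}" "b \<in> {1..n}" for a b
    using upper[OF that(1)] upper[OF that(2)] m_le[OF that(1)] m_le[OF that(2)] by linarith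
  then show ?thesis using p unfolding P_def d_def by auto
qed

text \<open>Turns a bound on the diameter into a bound on the distance to the mean, the only
  possible limit because the sum of the opinions is conserved.\<close>

lemma deviation_from_mean_le:
  fixes y :: "'a \<Rightarrow> real"
  assumes "finite A" "\<And>b. b \<in> A \<Longrightarrow> \<bar>y a - y b\<bar> \<le> D" "A \<noteq> {}"
  shows "\<bar>y a - (\<Sum>b\<in>A. y b) / real (card A)\<bar> \<le> D"
proof -
  have pos: "real (card A) > 0" using assms by (simp add: card_gt_0_iff)
  have "real (card A) * (y a - (\<Sum>b\<in>A. y b) / real (card A)) = (\<Sum>b\<in>A. y a - y b)"
    using pos by (simp add: sum_subtractf field_simps)
  also have "\<bar>\<dots>\<bar> \<le> real (card A) * D"
    using assms by (intro order.trans[OF sum_abs] sum_bounded_above) auto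
  finally show ?thesis using pos by (simp add: abs_mult)
qed

lemma consensus_reachable:
  assumes "n \<ge> 2" "max_gap n y < \<epsilon>" "0 < \<mu>" "\<mu> < 1"
  shows "\<exists>r. communication_regime n r \<and> leads_to_consensus n \<epsilon> \<mu> y r"
proof -
  define Q where "Q = (\<lambda>y p. p \<in> agent_pairs n \<and> \<bar>y (fst p) - y (snd p)\<bar> < \<epsilon> \<and>
    (\<forall>a\<in>{1..n}. \<forall>b\<in>{1..n}. \<bar>y a - y b\<bar> \<le> real n * \<bar>y (fst p) - y (snd p)\<bar>))"
  define pick where "pick = (\<lambda>y. SOME p. Q y p)"
  \<comment> \<open>The regime depends on the profiles it produces, so the trajectory
    \<open>z\<close> is built first and \<open>r\<close> is read off from it; the fact
    \<open>wd\<close> below identifies \<open>z\<close> with the dynamics under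
    \<open>r\<close>.\<close>
  define z where "z = rec_nat y (\<lambda>_ w. wd_step \<epsilon> \<mu> (pick w) w)"
  define r where "r = (\<lambda>t. pick (z t))"
  have z_simps: "z 0 = y" "z (Suc t) = wd_step \<epsilon> \<mu> (r t) (z t)" for t
    by (simp_all add: z_def r_def)
  have pick: "Q w (pick w)" if "max_gap n w < \<epsilon>" for w
    unfolding pick_def using wide_close_pair[OF assms(1) that] unfolding Q_def Bex_def by (rule someI_ex)
  \<comment> \<open>This invariant keeps a suitable pair available at every time.\<close>
  have small: "max_gap n (z t) < \<epsilon>" for t
  proof (induction t)
    case (Suc t)
    then have "r t \<in> agent_pairs n" using pick[of "z t"] by (simp add: Q_def r_def)
    then show ?case using Suc max_gap_wd_step[OF assms(1), of "r t" \<mu> \<epsilon> "z t"] assms z_simps by force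
  qed (simp add: z_simps assms)
  have Q: "Q (z t) (r t)" for t using pick[OF small] by (simp add: r_def)
  then have regime: "communication_regime n r"
    by (simp add: communication_regime_def Q_def)
  have wd: "wd \<epsilon> \<mu> y r t = z t" for t by (induction t) (simp_all add: z_simps)
  define g where "g = (\<lambda>t. z t (fst (r t)) - z t (snd (r t)))"
  define V where "V = (\<lambda>t. \<Sum>k=1..n. (z t k)\<^sup>2)"
  define c where "c = (\<Sum>k=1..n. y k) / real n"
  have dV: "V (Suc t) = V t - 2 * \<mu> * (1 - \<mu>) * (g t)\<^sup>2"
    and sum_Suc: "(\<Sum>k=1..n. z (Suc t) k) = (\<Sum>k=1..n. z t k)" for t
  proof -
    obtain i j where ij: "r t = (i, j)" by fastforce
    then have "i \<in> {1..n}" "j \<in> {1..n}" "i \<noteq> j" "\<bar>z t i - z t j\<bar> < \<epsilon>"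
      using Q[of t] by (auto simp: Q_def agent_pairs_def)
    then show "V (Suc t) = V t - 2 * \<mu> * (1 - \<mu>) * (g t)\<^sup>2"
        "(\<Sum>k=1..n. z (Suc t) k) = (\<Sum>k=1..n. z t k)"
      unfolding V_def g_def z_simps ij
      by (simp_all add: sum_squares_wd_step sum_wd_step_eq)
  qed
  have mean: "(\<Sum>k=1..n. z t k) = (\<Sum>k=1..n. y k)" for t
    by (induction t) (simp_all only: sum_Suc, simp add: z_simps)
  have "decseq V" by (rule decseq_SucI) (use dV assms in simp)
  moreover have "0 \<le> V t" for t by (simp add: V_def sum_nonneg)
  ultimately obtain L where L: "V \<longlonglongrightarrow> L" using decseq_convergent by metis
  \<comment> \<open>\<open>V\<close> converges, so its decrements, which are fixed multiples of
    \<open>(g t)\<^sup>2\<close>, tend to 0.\<close>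
  have "(\<lambda>t. (V t - V (Suc t)) / (2 * \<mu> * (1 - \<mu>))) \<longlonglongrightarrow> (L - L) / (2 * \<mu> * (1 - \<mu>))"
    using assms by (intro tendsto_intros L LIMSEQ_Suc) auto
  then have "(\<lambda>t. (g t)\<^sup>2) \<longlonglongrightarrow> 0" using assms by (simp add: dV)
  then have "(\<lambda>t. sqrt ((g t)\<^sup>2)) \<longlonglongrightarrow> sqrt 0" by (rule tendsto_real_sqrt)
  then have g0: "(\<lambda>t. real n * \<bar>g t\<bar>) \<longlonglongrightarrow> 0" by (simp add: tendsto_mult_right_zero)
  have "(\<lambda>t. z t k) \<longlonglongrightarrow> c" if k: "k \<in> {1..n}" for k
  proof -
    have "\<bar>z t k - c\<bar> \<le> real n * \<bar>g t\<bar>" for t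
      using deviation_from_mean_le[of "{1..n}" "z t" k "real n * \<bar>g t\<bar>"] Q[of t] k
      unfolding mean by (auto simp: Q_def g_def c_def)
    then have "(\<lambda>t. z t k - c) \<longlonglongrightarrow> 0"
      by (intro tendsto_0_le[OF g0, where K = 1]) (auto simp: abs_mult)
    then show ?thesis using LIM_zero_iff by blast
  qed
  then have "leads_to_consensus n \<epsilon> \<mu> y r" unfolding leads_to_consensus_def wd by blast
  then show ?thesis using regime by blast
qed

section \<open>Time shifts and the upper bound for preventing consensus\<close>

lemma wd_add: "wd \<epsilon> \<mu> x r (t + T) = wd \<epsilon> \<mu> (wd \<epsilon> \<mu> x r T) (\<lambda>s. r (s + T)) t"
  by (induction t) simp_all

lemma wd_cong: "(\<And>s. s < t \<Longrightarrow> r s = q s) \<Longrightarrow> wd \<epsilon> \<mu> x r t = wd \<epsilon> \<mu> x q t"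
  by (induction t) simp_all

text \<open>Convergence ignores a finite initial stretch; this allows a regime to be spliced after a
  prescribed prefix.\<close>

lemma leads_to_consensus_shift:
  "leads_to_consensus n \<epsilon> \<mu> x r \<longleftrightarrow>
     leads_to_consensus n \<epsilon> \<mu> (wd \<epsilon> \<mu> x r T) (\<lambda>s. r (s + T))"
proof -
  have "(\<lambda>t. wd \<epsilon> \<mu> x r t k) \<longlonglongrightarrow> c \<longleftrightarrow> (\<lambda>t. wd \<epsilon> \<mu> x r (t + T) k) \<longlonglongrightarrow> c" for k c
    by (rule iffI[OF LIMSEQ_ignore_initial_segment LIMSEQ_offset])
  then show ?thesis unfolding leads_to_consensus_def wd_add by simp
qed

text \<open>A prefix cannot raise \<open>max_gap\<close>. If this is below \<open>\<epsilon>\<close>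
  at the start, a regime from \<open>consensus_reachable\<close> can be appended to any
  prefix.\<close>

lemma preventing_consensus_imp_le:
  assumes "n \<ge> 2" "0 < \<mu>" "\<mu> < 1" "preventing_consensus_possible n \<epsilon> \<mu> x"
  shows "\<epsilon> \<le> max_gap n x"
proof (rule ccontr)
  assume neg: "\<not> \<epsilon> \<le> max_gap n x"
  obtain T p where p: "\<forall>t<T. p t \<in> agent_pairs n"
    and none: "\<And>r. communication_regime n r \<Longrightarrow> \<forall>t<T. r t = p t \<Longrightarrow> \<not> leads_to_consensus n \<epsilon> \<mu> x r"
    using assms unfolding preventing_consensus_possible_def by blast
  have "max_gap n (wd \<epsilon> \<mu> x p T) < \<epsilon>"
    using max_gap_wd[of n T p \<mu> \<epsilon> x] p assms neg by simp
  then obtain q where q: "communication_regime n q" "leads_to_consensus n \<epsilon> \<mu> (wd \<epsilon> \<mu> x p T) q"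
    using consensus_reachable assms by blast
  define r where "r = (\<lambda>t. if t < T then p t else q (t - T))"
  have "communication_regime n r" using q p by (auto simp: communication_regime_def r_def)
  moreover have "leads_to_consensus n \<epsilon> \<mu> x r"
    using q wd_cong[of T r p \<epsilon> \<mu> x] by (subst leads_to_consensus_shift[of _ _ _ _ _ T]) (simp add: r_def)
  ultimately show False using none by (simp add: r_def)
qed

text \<open>Prepending \<open>p\<close> to a preventing prefix lets such prefixes be built one pair
  at a time in an induction.\<close>

lemma preventing_consensus_step:
  assumes "p \<in> agent_pairs n" "preventing_consensus_possible n \<epsilon> \<mu> (wd_step \<epsilon> \<mu> p x)"
  shows "preventing_consensus_possible n \<epsilon> \<mu> x"
proof -
  obtain T q where q: "\<forall>t<T. q t \<in> agent_pairs n"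
    and none: "\<And>r. communication_regime n r \<Longrightarrow> \<forall>t<T. r t = q t \<Longrightarrow>
      \<not> leads_to_consensus n \<epsilon> \<mu> (wd_step \<epsilon> \<mu> p x) r"
    using assms unfolding preventing_consensus_possible_def by blast
  have "\<forall>t<Suc T. case_nat p q t \<in> agent_pairs n" using q assms by (auto split: nat.split)
  moreover have "\<not> leads_to_consensus n \<epsilon> \<mu> x r"
    if r: "communication_regime n r" "\<forall>t<Suc T. r t = case_nat p q t" for r
  proof -
    have "r 0 = p" using r by auto
    moreover have "\<forall>t<T. r (Suc t) = q t" using r by auto
    moreover have "communication_regime n (\<lambda>t. r (Suc t))" using r by (simp add: communication_regime_def)
    ultimately show ?thesis
      using none[of "\<lambda>t. r (Suc t)"] by (subst leads_to_consensus_shift[of _ _ _ _ _ 1]) simp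
  qed
  ultimately show ?thesis unfolding preventing_consensus_possible_def by blast
qed

section \<open>Preventing consensus by separation\<close>

text \<open>Agents on opposite sides of the gap never interact, and averaging within one side stays
  on that side, so both bounds persist under every regime. The empty prefix already works.\<close>

lemma preventing_consensus_of_gap:
  assumes "0 < \<epsilon>" "0 \<le> \<mu>" "\<mu> \<le> 1" "1 \<le> k" "k < n"
    and low: "\<And>i. i \<in> {1..k} \<Longrightarrow> y i \<le> a" and high: "\<And>i. i \<in> {k<..n} \<Longrightarrow> a + \<epsilon> \<le> y i"
  shows "preventing_consensus_possible n \<epsilon> \<mu> y"
proof -
  have "\<not> leads_to_consensus n \<epsilon> \<mu> y r" if r: "communication_regime n r" for r
  proof
    let ?w = "wd \<epsilon> \<mu> y r"
    have conv_le: "(1 - \<mu>) * u + \<mu> * v \<le> b" if "u \<le> b" "v \<le> b" for u v b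
    proof -
      have "(1 - \<mu>) * u + \<mu> * v \<le> (1 - \<mu>) * b + \<mu> * b"
        using that assms by (intro add_mono mult_left_mono) auto
      then show ?thesis by (simp add: algebra_simps)
    qed
    have conv_ge: "b \<le> (1 - \<mu>) * u + \<mu> * v" if "b \<le> u" "b \<le> v" for u v b
      using conv_le[of "-u" "-b" "-v"] that by simp
    have inv: "(\<forall>i\<in>{1..k}. ?w t i \<le> a) \<and> (\<forall>i\<in>{k<..n}. a + \<epsilon> \<le> ?w t i)" for t
    proof (induction t)
      case 0
      then show ?case using low high by simp
    next
      case (Suc t)
      obtain i j where ij: "r t = (i, j)" by fastforce
      then have "i \<in> {1..n}" "j \<in> {1..n}" "i \<noteq> j"
        using r by (auto simp: communication_regime_def agent_pairs_def dest: spec[of _ t])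
      then have "i \<in> {1..k} \<or> i \<in> {k<..n}" "j \<in> {1..k} \<or> j \<in> {k<..n}" by auto
      moreover have "\<not> \<bar>?w t u - ?w t v\<bar> < \<epsilon>" "\<not> \<bar>?w t v - ?w t u\<bar> < \<epsilon>"
        if "u \<in> {1..k}" "v \<in> {k<..n}" for u v
      proof -
        have "?w t u \<le> a" "a + \<epsilon> \<le> ?w t v" using Suc.IH that by blast+
        then show "\<not> \<bar>?w t u - ?w t v\<bar> < \<epsilon>" "\<not> \<bar>?w t v - ?w t u\<bar> < \<epsilon>" by linarith+
      qed
      ultimately consider "i \<in> {1..k}" "j \<in> {1..k}" | "i \<in> {k<..n}" "j \<in> {k<..n}"
        | "\<not> \<bar>?w t i - ?w t j\<bar> < \<epsilon>"
        by blast
      then show ?case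
      proof cases
        case 3
        then show ?thesis using Suc.IH by (simp add: ij wd_step_far)
      qed (use Suc.IH in \<open>auto simp: ij wd_step_def add.commute[of "\<mu> * _"] intro!: conv_le conv_ge\<close>)
    qed
    assume "leads_to_consensus n \<epsilon> \<mu> y r"
    then obtain c where c: "\<And>i. i \<in> {1..n} \<Longrightarrow> (\<lambda>t. ?w t i) \<longlonglongrightarrow> c"
      unfolding leads_to_consensus_def by blast
    have "c \<le> a" using inv assms by (intro LIMSEQ_le_const2[OF c[of 1]]) auto
    moreover have "a + \<epsilon> \<le> c" using inv assms by (intro LIMSEQ_le_const[OF c[of n]]) auto
    ultimately show False using assms by simp
  qed
  then show ?thesis unfolding preventing_consensus_possible_def by (intro exI[of _ 0]) auto
qed

lemma preventing_consensus_of_adjacent_gap: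
  assumes "0 < \<epsilon>" "0 \<le> \<mu>" "\<mu> \<le> 1" "mono_on {1..n} y" "1 \<le> k" "k < n" "\<epsilon> \<le> y (Suc k) - y k"
  shows "preventing_consensus_possible n \<epsilon> \<mu> y"
proof (rule preventing_consensus_of_gap[where a = "y k"])
  show "y i \<le> y k" if "i \<in> {1..k}" for i
    using that assms by (intro mono_onD[OF assms(4)]) auto
  show "y k + \<epsilon> \<le> y i" if "i \<in> {k<..n}" for i
    using that assms mono_onD[OF assms(4), of "Suc k" i] by auto
qed (use assms in auto)

text \<open>For \<open>\<mu> \<le> 1/2\<close> both agents move towards each other by at most half
  their distance, so they do not cross, and they stay between their neighbours.\<close>

lemma mono_on_wd_step_adjacent:
  assumes mono: "mono_on {1..n} y" and "1 \<le> i" "i < n" "0 \<le> \<mu>" "\<mu> \<le> 1/2"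
  shows "mono_on {1..n} (wd_step \<epsilon> \<mu> (i, Suc i) y)"
proof (rule mono_onI)
  fix a b assume ab: "a \<in> {1..n}" "b \<in> {1..n}" "a \<le> b"
  have le: "y i \<le> y (Suc i)" using assms by (intro mono_onD[OF mono]) auto
  have eq: "(1 - \<mu>) * y i + \<mu> * y (Suc i) = y i + \<mu> * (y (Suc i) - y i)"
    "\<mu> * y i + (1 - \<mu>) * y (Suc i) = y (Suc i) - \<mu> * (y (Suc i) - y i)"
    by (simp_all add: algebra_simps)
  have half: "0 \<le> \<mu> * (y (Suc i) - y i)" "\<mu> * (y (Suc i) - y i) \<le> 1/2 * (y (Suc i) - y i)"
    using le assms by (simp, intro mult_right_mono, auto)
  have *: "y a \<le> y b" using ab by (intro mono_onD[OF mono]) auto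
  have 1: "y a \<le> y i" if "a \<le> i" using that ab assms by (intro mono_onD[OF mono]) auto
  have 2: "y (Suc i) \<le> y b" if "Suc i \<le> b" using that ab assms by (intro mono_onD[OF mono]) auto
  consider "b < i" | "b = i" "a < i" | "a = i" "b = i" | "b = Suc i" "a < i" | "b = Suc i" "a = i"
    | "a = Suc i" "b = Suc i" | "b > Suc i" "a < i" | "b > Suc i" "a = i" | "b > Suc i" "a = Suc i" | "a > Suc i"
    using ab by linarith
  then show "wd_step \<epsilon> \<mu> (i, Suc i) y a \<le> wd_step \<epsilon> \<mu> (i, Suc i) y b"
    using ab half le * 1 2 by cases (auto simp: wd_step_def eq)
qed

lemma chain_le:
  fixes y :: "nat \<Rightarrow> real"
  assumes "a \<le> b" "\<And>i. a \<le> i \<Longrightarrow> i < b \<Longrightarrow> y (Suc i) - y i \<le> d"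
  shows "y b - y a \<le> real (b - a) * d"
  using assms
proof (induction b rule: dec_induct)
  case (step m)
  then have "y m - y a \<le> real (m - a) * d" "y (Suc m) - y m \<le> d" by auto
  then show ?case using step(1) by (simp add: Suc_diff_le algebra_simps)
qed simp

lemma mean_gap_initial:
  assumes "k \<le> n"
  shows "mean_gap n {1..k} y =
    1 / real (n - k) * (\<Sum>i=k+1..n. y i) - 1 / real k * (\<Sum>j=1..k. y j)"
proof -
  have "{1..n} - {1..k} = {k+1..n}" by auto
  then show ?thesis by (simp add: mean_gap_def)
qed

text \<open>Chaining at most \<open>n\<close> gaps of size at most \<open>d\<close>, the upper mean
  exceeds \<open>y (Suc k)\<close>, and the lower mean falls below \<open>y k\<close>, by at most
  \<open>real n * d\<close>.\<close>

lemma mean_gap_le_adjacent_gap: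
  assumes "1 \<le> k" "k < n" "0 \<le> d"
    and d: "\<And>i. 1 \<le> i \<Longrightarrow> i < n \<Longrightarrow> i \<noteq> k \<Longrightarrow> y (Suc i) - y i \<le> d"
  shows "mean_gap n {1..k} y \<le> y (Suc k) - y k + 2 * real n * d"
proof -
  have mul: "real l * d \<le> real n * d" if "l \<le> n" for l
    using that assms by (intro mult_right_mono) auto
  have "y i \<le> y (Suc k) + real n * d" if "i \<in> {k+1..n}" for i
    using chain_le[of "Suc k" i y d] mul[of "i - Suc k"] that d by fastforce
  then have "(\<Sum>i=k+1..n. y i) \<le> real (card {k+1..n}) * (y (Suc k) + real n * d)"
    by (intro sum_bounded_above) auto
  then have high: "1 / real (n - k) * (\<Sum>i=k+1..n. y i) \<le> y (Suc k) + real n * d"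
    using assms by (simp add: field_simps)
  have "y k - real n * d \<le> y i" if "i \<in> {1..k}" for i
  proof -
    have "y k - y i \<le> real (k - i) * d"
      using that d assms by (intro chain_le) auto
    then show ?thesis using mul[of "k - i"] assms by linarith
  qed
  then have "real (card {1..k}) * (y k - real n * d) \<le> (\<Sum>j=1..k. y j)"
    by (intro sum_bounded_below) auto
  then have "y k - real n * d \<le> 1 / real k * (\<Sum>j=1..k. y j)"
    using assms by (simp add: field_simps)
  with high show ?thesis using assms by (subst mean_gap_initial) auto
qed

text \<open>Contracting a gap above \<open>d\<close> inside a group preserves both group means and
  costs at least \<open>\<eta>\<close> of the sum of squares. The induction runs over the number of
  contractions that the sum of squares can pay for.\<close>

lemma preventing_consensus_of_mean_gap:
  assumes "0 < \<epsilon>" "0 < \<mu>" "\<mu> \<le> 1/2" "1 \<le> k" "k < n"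
    and "mono_on {1..n} y" "\<epsilon> < mean_gap n {1..k} y"
  shows "preventing_consensus_possible n \<epsilon> \<mu> y"
proof -
  define m where "m = mean_gap n {1..k} y"
  \<comment> \<open>Chosen so that \<open>m - 2 * real n * d = \<epsilon>\<close>: gaps of at most
    \<open>d\<close> inside the groups force a middle gap of at least
    \<open>\<epsilon>\<close>.\<close>
  define d where "d = (m - \<epsilon>) / (2 * real n)"
  define \<eta> where "\<eta> = 2 * \<mu> * (1 - \<mu>) * d\<^sup>2"
  have "d > 0" using assms by (simp add: d_def m_def)
  then have "\<eta> > 0" using assms by (simp add: \<eta>_def)
  have "preventing_consensus_possible n \<epsilon> \<mu> w"
    if "(\<Sum>i=1..n. (w i)\<^sup>2) \<le> real N * \<eta>" "mono_on {1..n} w" "mean_gap n {1..k} w = m" for N w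
    using that
  proof (induction N arbitrary: w)
    case (Suc N)
    show ?case
    proof (cases "\<exists>i. 1 \<le> i \<and> i < n \<and> \<epsilon> \<le> w (Suc i) - w i")
      case True
      then show ?thesis
        using preventing_consensus_of_adjacent_gap[OF _ _ _ Suc.prems(2)] assms by auto
    next
      case no_gap: False
      show ?thesis
      proof (cases "\<exists>i. 1 \<le> i \<and> i < n \<and> i \<noteq> k \<and> d < w (Suc i) - w i")
        case True
        then obtain i where i: "1 \<le> i" "i < n" "i \<noteq> k" "d < w (Suc i) - w i" by blast
        let ?w' = "wd_step \<epsilon> \<mu> (i, Suc i) w"
        \<comment> \<open>No adjacent gap has reached \<open>\<epsilon>\<close>, so the contraction
          takes effect.\<close>
        have close: "\<bar>w i - w (Suc i)\<bar> < \<epsilon>" using no_gap i \<open>d > 0\<close> by force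
        have "d\<^sup>2 \<le> (w i - w (Suc i))\<^sup>2"
          using i \<open>d > 0\<close> by (subst power2_commute) (intro power_mono, auto)
        then have "\<eta> \<le> 2 * \<mu> * (1 - \<mu>) * (w i - w (Suc i))\<^sup>2"
          unfolding \<eta>_def using assms by (intro mult_left_mono) auto
        then have "(\<Sum>j=1..n. (?w' j)\<^sup>2) \<le> real N * \<eta>"
          using i close Suc.prems(1) sum_squares_wd_step[of "{1..n}" i "Suc i" w \<epsilon> \<mu>]
          by (simp add: algebra_simps)
        moreover have "mono_on {1..n} ?w'"
          using i assms Suc.prems by (intro mono_on_wd_step_adjacent) auto
        \<comment> \<open>As \<open>i \<noteq> k\<close>, the agents \<open>i\<close> and
          \<open>Suc i\<close> belong to the same group, whose sum is conserved.\<close>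
        moreover have "mean_gap n {1..k} ?w' = m"
          unfolding Suc.prems(3)[symmetric] mean_gap_def using i assms
          by (subst (1 2) sum_wd_step_eq) auto
        ultimately have "preventing_consensus_possible n \<epsilon> \<mu> ?w'" by (rule Suc.IH)
        moreover have "(i, Suc i) \<in> agent_pairs n" using i by (simp add: agent_pairs_def)
        ultimately show ?thesis by (rule preventing_consensus_step[rotated])
      next
        case False
        then have "mean_gap n {1..k} w \<le> w (Suc k) - w k + 2 * real n * d"
          using assms \<open>d > 0\<close> by (intro mean_gap_le_adjacent_gap) (auto simp: not_less)
        \<comment> \<open>By the choice of \<open>d\<close> the middle gap has reached
          \<open>\<epsilon>\<close>, contrary to \<open>no_gap\<close>.\<close>
        then have "\<epsilon> \<le> w (Suc k) - w k"
          using Suc.prems(3) assms by (simp add: d_def)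
        then show ?thesis using no_gap assms by auto
      qed
    qed
  next
    case 0
    \<comment> \<open>With the sum of squares used up, all opinions are 0 and so is the mean gap,
      contrary to \<open>m > \<epsilon> > 0\<close>.\<close>
    then have "(\<Sum>i=1..n. (w i)\<^sup>2) = 0" using sum_nonneg[of "{1..n}" "\<lambda>i. (w i)\<^sup>2"] by auto
    then have "\<forall>i\<in>{1..n}. w i = 0" by (simp add: sum_nonneg_eq_0_iff)
    then have "mean_gap n {1..k} w = 0" using assms by (simp add: mean_gap_def)
    then show ?case using 0 assms by (simp add: m_def)
  qed
  moreover obtain N where "(\<Sum>i=1..n. (y i)\<^sup>2) < real N * \<eta>"
    using reals_Archimedean3[OF \<open>\<eta> > 0\<close>] by blast
  ultimately show ?thesis using assms(6) m_def less_imp_le by metis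
qed

section \<open>Extremal subsets of sorted profiles\<close>

text \<open>Exchange argument: with \<open>k = card S\<close>, the sets \<open>{1..k} - S\<close>
  and \<open>S - {1..k}\<close> have equal size, and \<open>y k\<close> separates the values on the
  first from those on the second.\<close>

lemma sum_initial_le:
  fixes y :: "nat \<Rightarrow> real"
  assumes "mono_on {1..n} y" "S \<subseteq> {1..n}"
  shows "(\<Sum>i=1..card S. y i) \<le> (\<Sum>i\<in>S. y i)"
proof (cases "S = {}")
  case False
  define k where "k = card S"
  have fin: "finite S" using assms finite_subset by blast
  have k: "1 \<le> k" "k \<le> n" using False fin card_mono[OF _ assms(2)] by (auto simp: k_def Suc_le_eq card_gt_0_iff)
  have card: "card ({1..k} - S) = card (S - {1..k})"
  proof -
    have "k = card ({1..k} \<inter> S) + card ({1..k} - S)"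
      using card_Int_Diff[of "{1..k}" S] by simp
    moreover have "k = card ({1..k} \<inter> S) + card (S - {1..k})"
      using card_Int_Diff[OF fin, of "{1..k}"] by (simp only: k_def Int_commute)
    ultimately show ?thesis by linarith
  qed
  have "(\<Sum>i\<in>{1..k} - S. y i) \<le> real (card ({1..k} - S)) * y k"
    using k by (intro sum_bounded_above mono_onD[OF assms(1)]) auto
  also have "\<dots> \<le> (\<Sum>i\<in>S - {1..k}. y i)"
    unfolding card using k assms(2) by (intro sum_bounded_below mono_onD[OF assms(1)]) auto
  finally have diff: "(\<Sum>i\<in>{1..k} - S. y i) \<le> (\<Sum>i\<in>S - {1..k}. y i)" .
  have "sum y {1..k} = sum y ({1..k} \<inter> S) + sum y ({1..k} - S)"
    by (intro sum.Int_Diff) simp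
  moreover have "sum y S = sum y ({1..k} \<inter> S) + sum y (S - {1..k})"
    using sum.Int_Diff[OF fin, of y "{1..k}"] by (simp only: Int_commute)
  ultimately show ?thesis unfolding k_def[symmetric] using diff by linarith
qed simp

text \<open>The total over all agents is fixed, so among sets of one size the mean gap is largest
  where the sum over the set is smallest.\<close>

lemma mean_gap_le_initial:
  assumes "mono_on {1..n} y" "S \<noteq> {}" "S \<subset> {1..n}"
  shows "mean_gap n S y \<le> mean_gap n {1..card S} y"
proof -
  have fin: "finite S" using assms finite_subset by blast
  have k: "0 < card S" "card S < n"
    using assms fin psubset_card_mono[of "{1..n}" S] by (auto simp: card_gt_0_iff)
  have card: "card ({1..n} - T) = n - card T" if "T \<subseteq> {1..n}" for T
    using that by (simp add: card_Diff_subset finite_subset)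
  have le: "(\<Sum>i=1..card S. y i) \<le> (\<Sum>i\<in>S. y i)"
    using assms by (intro sum_initial_le) auto
  have compl: "(\<Sum>i\<in>{1..n} - T. y i) = (\<Sum>i=1..n. y i) - (\<Sum>i\<in>T. y i)" if "T \<subseteq> {1..n}" for T
    using that by (intro sum_diff) auto
  have "{1..card S} \<subseteq> {1..n}" "S \<subseteq> {1..n}" using k assms by auto
  then show ?thesis unfolding mean_gap_def
    by (simp only: card compl card_atLeastAtMost diff_Suc_1) (intro diff_mono divide_right_mono le diff_left_mono of_nat_0_le_iff)
qed

lemma max_gap_sorted:
  assumes "n \<ge> 2" "mono_on {1..n} y"
  shows "max_gap n y = Max ((\<lambda>k. mean_gap n {1..k} y) ` {1..n - 1})"
proof (rule antisym)
  show "max_gap n y \<le> Max ((\<lambda>k. mean_gap n {1..k} y) ` {1..n - 1})"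
  proof (rule max_gap_le[OF assms(1)])
    fix S assume S: "S \<noteq> {}" "S \<subset> {1..n}"
    then have "card S \<in> {1..n - 1}"
      using psubset_card_mono[of "{1..n}" S] finite_subset[of S "{1..n}"]
      by (auto simp: Suc_le_eq card_gt_0_iff)
    then have "mean_gap n {1..card S} y \<le> Max ((\<lambda>k. mean_gap n {1..k} y) ` {1..n - 1})"
      by (intro Max_ge) auto
    then show "mean_gap n S y \<le> Max ((\<lambda>k. mean_gap n {1..k} y) ` {1..n - 1})"
      using mean_gap_le_initial[OF assms(2) S] by linarith
  qed
  have "{1..k} \<noteq> {} \<and> {1..k} \<subset> {1..n}" if "k \<in> {1..n - 1}" for k
    using that by auto
  then show "Max ((\<lambda>k. mean_gap n {1..k} y) ` {1..n - 1}) \<le> max_gap n y"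
    using assms(1) by (intro Max.boundedI) (auto intro!: mean_gap_le_max_gap)
qed

text \<open>Agent 1 holds a smallest opinion, whence \<open>S = {1}\<close>. The bound serves the
  element 0 in the set of \<open>eps_high\<close>.\<close>

lemma max_gap_nonneg:
  assumes "n \<ge> 2" "mono_on {1..n} y"
  shows "0 \<le> max_gap n y"
proof -
  have S: "{1::nat} \<noteq> {}" "{1} \<subset> {1..n}" using singleton_psubset[OF assms(1)] by simp_all
  obtain i j where ij: "i \<in> {1}" "j \<in> {1..n} - {1}" "y j - y i \<le> mean_gap n {1} y"
    by (rule mean_gap_witness[OF S, where y = y])
  then have "y i \<le> y j" using assms by (intro mono_onD[OF assms(2)]) auto
  then show ?thesis using ij mean_gap_le_max_gap[OF S, of y] by linarith
qed

section \<open>The supremum of the preventing bounds\<close>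

theorem proposition2:
  fixes n :: nat and x :: "nat \<Rightarrow> real" and \<mu> :: real
  assumes "n \<ge> 2"
    and "\<And>i j. 1 \<le> i \<Longrightarrow> i \<le> j \<Longrightarrow> j \<le> n \<Longrightarrow> x i \<le> x j"
    and "0 < \<mu>" and "\<mu> < 1 / 2"
  shows "eps_high n \<mu> x =
    Max ((\<lambda>k. 1 / real (n - k) * (\<Sum>i=k+1..n. x i) - 1 / real k * (\<Sum>j=1..k. x j)) ` {1..n - 1})"
proof -
  have mono: "mono_on {1..n} x" by (rule mono_onI, rule assms(2)) simp_all
  have Max_eq: "Max ((\<lambda>k. 1 / real (n - k) * (\<Sum>i=k+1..n. x i) - 1 / real k * (\<Sum>j=1..k. x j)) ` {1..n - 1})
      = max_gap n x"
    unfolding max_gap_sorted[OF assms(1) mono]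
    by (intro arg_cong[where f = Max] image_cong refl mean_gap_initial[symmetric]) auto
  have possible: "preventing_consensus_possible n \<epsilon> \<mu> x" if "0 < \<epsilon>" "\<epsilon> < max_gap n x" for \<epsilon>
  proof -
    have "max_gap n x \<in> (\<lambda>k. mean_gap n {1..k} x) ` {1..n - 1}"
      unfolding max_gap_sorted[OF assms(1) mono] using assms(1) by (intro Max_in) auto
    then obtain k where "k \<in> {1..n - 1}" "max_gap n x = mean_gap n {1..k} x" by blast
    then show ?thesis
      using that assms mono by (intro preventing_consensus_of_mean_gap[of \<epsilon> \<mu> k]) auto
  qed
  show ?thesis
    unfolding Max_eq eps_high_def
  proof (rule cSup_eq_non_empty)
    show "\<epsilon> \<le> max_gap n x"
      if "\<epsilon> \<in> insert 0 {\<epsilon>. 0 < \<epsilon> \<and> preventing_consensus_possible n \<epsilon> \<mu> x}" for \<epsilon>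
      using that preventing_consensus_imp_le[of n \<mu> \<epsilon> x] max_gap_nonneg[OF assms(1) mono] assms by auto
    show "max_gap n x \<le> b"
      if b: "\<And>\<epsilon>. \<epsilon> \<in> insert 0 {\<epsilon>. 0 < \<epsilon> \<and> preventing_consensus_possible n \<epsilon> \<mu> x} \<Longrightarrow> \<epsilon> \<le> b" for b
    \<comment> \<open>Bounds strictly below \<open>max_gap n x\<close> are preventing, but the value
      itself may fail to be, so it is approached from below. Nonpositive \<open>\<epsilon>\<close>
      are covered by the inserted 0.\<close>
    proof (rule dense_le)
      fix \<epsilon> assume "\<epsilon> < max_gap n x"
      then show "\<epsilon> \<le> b" using b[of \<epsilon>] b[of 0] possible[of \<epsilon>] by (cases "0 < \<epsilon>") auto
    qed
  qed simp
qed

end
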